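(* Let $(S,+,\cdot)$ be a left semibrace, and let $e$ be the identity of the group $(S,\cdot)$. For $a,b\in S$ put $\overline{\lambda}_a(b)=a(a^{-1}+b)$ and $\overline{\rho}_b(a)=(a^{-1}+b)^{-1}b$. The following statements are equivalent: (1) $(S,+,\cdot)$ is strong. (2) $c+a(e+b)=c+ab$ for all $a,b,c\in S$. (3) $e+a+e=e+au+e$ for all $a\in S$ and all $u\in E(S,+)$. (4) The map $\overline{r}_S:S\times S\to S\times S$, $(a,b)\mapsto(\overline{\lambda}_a(b),\overline{\rho}_b(a))$, is a set-theoretic solution of the Yang-Baxter equation. (5) $a+b(b^{-1}+c)\bigl(e+(b^{-1}+c)^{-1}c\bigr)=a+b(e+c)$ for all $a,b,c\in S$.
   Context: Multiplication has higher precedence than addition. A left semibrace is a triple $(S,+,\cdot)$ such that $(S,+)$ is a (not necessarily commutative) semigroup, $(S,\cdot)$ is a group, and $x(y+z)=xy+x(x^{-1}+z)$ for all $x,y,z\in S$, where $x^{-1}$ is the inverse of $x$ in $(S,\cdot)$. $E(S,+)=\{u\in S: u+u=u\}$ is the set of idempotents of $(S,+)$. For $a\in S$ define the map $\overline{\rho}_a:S\to S$, $b\mapsto (b^{-1}+a)^{-1}a$. The left semibrace is called strong if the map $\overline{\rho}:(S,\cdot)\to\mathrm{Map}(S,S)$, $a\mapsto\overline{\rho}_a$, is a semigroup anti-homomorphism, i.e. $\overline{\rho}_{ab}=\overline{\rho}_b\circ\overline{\rho}_a$ for all $a,b\in S$, where $\mathrm{Map}(S,S)$ is the semigroup of all maps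 $S\to S$ under composition. A map $r:S\times S\to S\times S$ is a set-theoretic solution of the Yang-Baxter equation if $(r\times\mathrm{id}_S)(\mathrm{id}_S\times r)(r\times\mathrm{id}_S)=(\mathrm{id}_S\times r)(r\times\mathrm{id}_S)(\mathrm{id}_S\times r)$ as maps $S\times S\times S\to S\times S\times S$ (no bijectivity is required). *)

theory Defs
  imports Main
begin

text \<open>
  A left semibrace lives on a whole (nonempty) type.  Addition is an arbitrary, possibly
  noncommutative, semigroup, and multiplication is a group with identity \<open>e\<close> and
  inversion \<open>minv\<close> (the locale \<open>group\<close> of \<open>HOL.Groups\<close>).
\<close>

locale left_semibrace =
  plus: semigroup add + times: group mult e minv
  for add :: "'a \<Rightarrow> 'a \<Rightarrow> 'a" (infixl \<open>\<oplus>\<close> 65)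
    and mult :: "'a \<Rightarrow> 'a \<Rightarrow> 'a" (infixl \<open>\<otimes>\<close> 70)
    and e :: 'a
    and minv :: "'a \<Rightarrow> 'a" +
  assumes left_semibrace_distrib: "x \<otimes> (y \<oplus> z) = x \<otimes> y \<oplus> x \<otimes> (minv x \<oplus> z)"

definition idempotents :: "('a \<Rightarrow> 'a \<Rightarrow> 'a) \<Rightarrow> 'a set" where
  "idempotents add = {u. add u u = u}"

definition lambda_bar ::
  "('a \<Rightarrow> 'a \<Rightarrow> 'a) \<Rightarrow> ('a \<Rightarrow> 'a \<Rightarrow> 'a) \<Rightarrow> ('a \<Rightarrow> 'a) \<Rightarrow> 'a \<Rightarrow> 'a \<Rightarrow> 'a" where
  "lambda_bar add mult minv a b = mult a (add (minv a) b)"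

text \<open>The first element argument is the subscript: \<open>rho_bar add mult minv a\<close> is the map
  sending \<open>b\<close> to the product of the inverse of \<open>add (minv b) a\<close> with \<open>a\<close>.\<close>

definition rho_bar ::
  "('a \<Rightarrow> 'a \<Rightarrow> 'a) \<Rightarrow> ('a \<Rightarrow> 'a \<Rightarrow> 'a) \<Rightarrow> ('a \<Rightarrow> 'a) \<Rightarrow> 'a \<Rightarrow> 'a \<Rightarrow> 'a" where
  "rho_bar add mult minv a b = mult (minv (add (minv b) a)) a"

definition strong ::
  "('a \<Rightarrow> 'a \<Rightarrow> 'a) \<Rightarrow> ('a \<Rightarrow> 'a \<Rightarrow> 'a) \<Rightarrow> ('a \<Rightarrow> 'a) \<Rightarrow> bool" where
  "strong add mult minv \<longleftrightarrow>
    (\<forall>a b. rho_bar add mult minv (mult a b) = rho_bar add mult minv b \<circ> rho_bar add mult minv a)"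

definition r_bar ::
  "('a \<Rightarrow> 'a \<Rightarrow> 'a) \<Rightarrow> ('a \<Rightarrow> 'a \<Rightarrow> 'a) \<Rightarrow> ('a \<Rightarrow> 'a) \<Rightarrow> 'a \<times> 'a \<Rightarrow> 'a \<times> 'a" where
  "r_bar add mult minv = (\<lambda>(a, b). (lambda_bar add mult minv a b, rho_bar add mult minv b a))"

text \<open>Triples are nested to the right, so \<open>id \<times> r\<close> is a \<open>map_prod\<close>, whereas \<open>r \<times> id\<close> has to
  be reassociated.\<close>

definition prod_id :: "('a \<times> 'a \<Rightarrow> 'a \<times> 'a) \<Rightarrow> 'a \<times> 'a \<times> 'a \<Rightarrow> 'a \<times> 'a \<times> 'a" where
  "prod_id r = (\<lambda>(x, y, z). (fst (r (x, y)), snd (r (x, y)), z))"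

definition id_prod :: "('a \<times> 'a \<Rightarrow> 'a \<times> 'a) \<Rightarrow> 'a \<times> 'a \<times> 'a \<Rightarrow> 'a \<times> 'a \<times> 'a" where
  "id_prod r = map_prod id r"

definition yang_baxter_solution :: "('a \<times> 'a \<Rightarrow> 'a \<times> 'a) \<Rightarrow> bool" where
  "yang_baxter_solution r \<longleftrightarrow>
    prod_id r \<circ> id_prod r \<circ> prod_id r = id_prod r \<circ> prod_id r \<circ> id_prod r"

end

theory Submission
  imports Defs
begin

text \<open>
  Write \<open>\<lambda>\<^sub>a\<close> for \<open>lambda_bar (\<oplus>) (\<otimes>) minv a\<close>.  The whole proof is organised by the map \<open>a \<mapsto> \<lambda>\<^sub>a\<close>:
  the semibrace axiom reads \<open>x \<otimes> (y \<oplus> z) = x \<otimes> y \<oplus> \<lambda>\<^sub>x z\<close>, and it makes \<open>\<lambda>\<close> an action of the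
  multiplicative group by endomorphisms of the additive semigroup (\<open>lam_mult\<close>, \<open>lam_add\<close>), except
  that \<open>\<lambda>\<^sub>e\<close> is only the projection \<open>z \<mapsto> e \<oplus> z\<close> onto \<open>e \<oplus> S\<close>.

  Two conditions come from direct computation.  Because \<open>b \<oplus> \<lambda>\<^sub>b c = b \<otimes> (e \<oplus> c)\<close>, the composite
  of the right maps of \<open>b\<close> and \<open>c\<close> at \<open>a\<close> has inverse
  \<open>minv (b \<otimes> c) \<otimes> (minv a \<oplus> b \<otimes> (e \<oplus> c))\<close> (\<open>minv_rho_rho\<close>), while the right map of \<open>b \<otimes> c\<close> has the
  same inverse with \<open>b \<otimes> c\<close> in place of \<open>b \<otimes> (e \<oplus> c)\<close>; comparing them turns strongness into the
  absorption law \<open>c \<oplus> a \<otimes> (e \<oplus> b) = c \<oplus> a \<otimes> b\<close> (\<open>strong_iff\<close>).  The map \<open>r\<close> preserves products, and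
  the first component of the braid relation holds because \<open>\<lambda>\<close> is multiplicative; so only the third
  component is a condition, and the same formula turns it into the identity that says that
  \<open>a \<oplus> x \<otimes> (e \<oplus> y)\<close> does not change when \<open>(x, y)\<close> is replaced by its image under \<open>r\<close>
  (\<open>yang_baxter_iff\<close>).

  It remains to compare the absorption law and this invariance under \<open>r\<close> with the condition that
  \<open>e \<oplus> a \<otimes> u \<oplus> e\<close> is independent of the idempotent \<open>u\<close>.  This rests on two facts about the additive
  semigroup.  First, \<open>e \<oplus> v = v\<close> and \<open>v \<oplus> v = v\<close> imply \<open>v \<oplus> e = e\<close>: on \<open>e \<oplus> S\<close> the bijection \<open>\<lambda>\<^sub>v\<close>
  agrees with left multiplication by \<open>v\<close>, which forces the idempotents of \<open>e \<oplus> S\<close> to be a right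
  zero band.  In particular \<open>\<lambda>\<^sub>a u \<oplus> e = e\<close> for every idempotent \<open>u\<close> (\<open>lam_idempotent_add_e\<close>).
  Secondly, every \<open>b\<close> satisfies \<open>b \<oplus> x \<oplus> b = b\<close> for some \<open>x\<close> (\<open>add_regular\<close>), so that \<open>u = b \<oplus> x\<close> is
  an idempotent with \<open>u \<oplus> b = b\<close>.

  Since \<open>a \<otimes> (e \<oplus> u) = a \<oplus> \<lambda>\<^sub>a u\<close>, the first fact derives the condition on idempotents from the
  absorption law.  Conversely, the second fact lets one write
  \<open>a \<otimes> b = a \<otimes> (u \<oplus> b) = a \<otimes> u \<oplus> \<lambda>\<^sub>a b\<close>, where the condition on idempotents removes \<open>u\<close>.  The
  absorption law gives the invariance under \<open>r\<close> because it reduces \<open>a \<oplus> x \<otimes> (e \<oplus> y)\<close> to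
  \<open>a \<oplus> x \<otimes> y\<close>, and \<open>r\<close> preserves products.  Finally, the invariance applied to \<open>(a, c)\<close> with
  \<open>c = u \<oplus> \<lambda>\<^bsub>minv a\<^esub> e\<close> gives the condition on idempotents, as this \<open>c\<close> satisfies \<open>\<lambda>\<^sub>a c = e\<close>.
\<close>

context left_semibrace
begin

abbreviation lam :: "'a \<Rightarrow> 'a \<Rightarrow> 'a" where
  "lam \<equiv> lambda_bar (\<oplus>) (\<otimes>) minv"

abbreviation rho :: "'a \<Rightarrow> 'a \<Rightarrow> 'a" where
  "rho \<equiv> rho_bar (\<oplus>) (\<otimes>) minv"

section \<open>The left action\<close>

lemma mult_e [simp]: "x \<otimes> e = x"
  by (metis times.group_left_neutral times.left_inverse times.assoc times.right_inverse)

lemma mult_minv_cancel [simp]: "x \<otimes> (minv x \<otimes> y) = y" "minv x \<otimes> (x \<otimes> y) = y"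
  by (simp_all add: times.assoc [symmetric] times.group_left_neutral)

lemma minv_mult: "minv (x \<otimes> y) = minv y \<otimes> minv x"
  by (rule times.inverse_distrib_swap)

lemma mult_add: "x \<otimes> (y \<oplus> z) = x \<otimes> y \<oplus> lam x z"
  unfolding lambda_bar_def by (rule left_semibrace_distrib)

lemma add_e_add [simp]: "x \<oplus> (e \<oplus> y) = x \<oplus> y"
  by (metis left_semibrace_distrib times.group_left_neutral times.inverse_neutral)

lemma lam_e: "lam e x = e \<oplus> x"
  by (simp add: lambda_bar_def times.group_left_neutral)

lemma lam_mult: "lam (x \<otimes> y) z = lam x (lam y z)"
proof -
  have "y \<otimes> (minv y \<otimes> minv x \<oplus> z) = minv x \<oplus> lam y z"
    by (simp add: mult_add)
  then show ?thesis
    by (simp add: lambda_bar_def minv_mult times.assoc)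
qed

lemma lam_add: "lam x (y \<oplus> z) = lam x y \<oplus> lam x z"
proof -
  have "lam x (y \<oplus> z) = x \<otimes> ((minv x \<oplus> y) \<oplus> z)"
    by (simp add: lambda_bar_def plus.assoc)
  also have "\<dots> = x \<otimes> (minv x \<oplus> y) \<oplus> lam x z"
    by (rule mult_add)
  also have "\<dots> = lam x y \<oplus> lam x z"
    by (simp only: lambda_bar_def)
  finally show ?thesis .
qed

lemma e_add_lam [simp]: "e \<oplus> lam x y = lam x y"
  by (metis lam_e lam_mult times.group_left_neutral)

lemma lam_minv_cancel: "lam x (lam (minv x) y) = e \<oplus> y" "lam (minv x) (lam x y) = e \<oplus> y"
  by (simp_all add: lam_mult [symmetric] lam_e)

text \<open>
  The element \<open>k = e \<oplus> e\<close> is idempotent because an inner \<open>e\<close> can always be dropped.  Dividing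
  \<open>k \<oplus> k = k\<close> by \<open>k\<close> on the left shows that \<open>e\<close> lies in \<open>e \<oplus> S\<close>, on which adding \<open>e\<close> on the left
  has no effect.
\<close>

lemma e_add_e [simp]: "e \<oplus> e = e"
proof -
  define k where "k = e \<oplus> e"
  have "k \<oplus> k = k"
    by (simp add: k_def plus.assoc)
  then have "minv k \<otimes> (k \<oplus> k) = e"
    by simp
  then have "lam (minv k) k = e"
    by (simp add: mult_add)
  then show ?thesis
    by (metis e_add_lam)
qed

lemma add_lam_e: "x \<oplus> lam x e = x"
  by (metis mult_add e_add_e mult_e)

section \<open>Additive idempotents and regularity\<close>

text \<open>
  With \<open>w = minv v \<otimes> (v \<oplus> e)\<close>, the product \<open>v \<otimes> w\<close> is \<open>v \<oplus> e\<close>, while \<open>\<lambda>\<^sub>v w = e\<close>.  The two agree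
  because \<open>v = \<lambda>\<^sub>v e\<close> is absorbed on the left by every value of \<open>\<lambda>\<^sub>v\<close>.
\<close>

lemma idempotent_add_e:
  assumes idem: "v \<oplus> v = v" and left: "e \<oplus> v = v"
  shows "v \<oplus> e = e"
proof -
  let ?w = "lam (minv v) e"
  have "lam (minv v) v = e"
  proof -
    have "minv v \<otimes> (v \<oplus> v) = e"
      by (simp add: idem)
    then show ?thesis
      by (simp add: mult_add)
  qed
  then have fixed: "lam v e = v"
    using lam_minv_cancel(1) [of v v] left by simp
  have "v \<oplus> e = v \<oplus> lam v ?w"
    by (simp add: lam_minv_cancel)
  also have "\<dots> = lam v e \<oplus> lam v ?w"
    by (simp add: fixed)
  also have "\<dots> = lam v (e \<oplus> ?w)"
    by (simp only: lam_add)
  also have "\<dots> = e"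
    by (simp add: lam_minv_cancel)
  finally show ?thesis .
qed

lemma lam_idempotent_add_e:
  assumes "u \<oplus> u = u"
  shows "lam x u \<oplus> e = e"
proof (rule idempotent_add_e)
  show "lam x u \<oplus> lam x u = lam x u"
    by (simp add: lam_add [symmetric] assms)
qed simp

text \<open>
  For \<open>t = e \<oplus> t\<close> the relation \<open>minv t \<otimes> (e \<oplus> t) = e\<close>, moved by \<open>\<lambda>\<^sub>t\<close>, exhibits \<open>x = \<lambda>\<^sub>t (minv t)\<close> as a
  left inverse of \<open>t\<close> up to the idempotent \<open>\<lambda>\<^sub>t e\<close>.  For general \<open>b\<close> this is applied to
  \<open>t = e \<oplus> b\<close>, which cannot be distinguished from \<open>b\<close> by adding something on the left.  The
  right unit \<open>\<lambda>\<^sub>b e\<close> of \<open>b\<close> then swallows the idempotent.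
\<close>

lemma add_regular: "\<exists>x. b \<oplus> x \<oplus> b = b"
proof -
  define t where "t = e \<oplus> b"
  define x where "x = lam t (minv t)"
  have "minv t \<oplus> lam (minv t) t = e"
  proof -
    have "minv t \<otimes> (e \<oplus> t) = e"
      by (simp add: t_def)
    then show ?thesis
      by (simp add: mult_add)
  qed
  then have "lam t (minv t) \<oplus> lam t (lam (minv t) t) = lam t e"
    by (simp only: lam_add [symmetric])
  then have xb: "x \<oplus> b = lam t e"
    by (simp add: x_def lam_minv_cancel t_def)
  have absorb: "lam t e \<oplus> lam b e = lam b e"
  proof -
    have "lam t e \<oplus> lam b e = (lam t e \<oplus> e) \<oplus> lam b e"
      by (simp add: plus.assoc)
    also have "\<dots> = lam b e"
      by (simp add: lam_idempotent_add_e)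
    finally show ?thesis .
  qed
  have "b \<oplus> x \<oplus> b = b \<oplus> (x \<oplus> (b \<oplus> lam b e))"
    by (simp add: add_lam_e plus.assoc)
  also have "\<dots> = b \<oplus> (lam t e \<oplus> lam b e)"
    by (simp add: xb plus.assoc [symmetric])
  also have "\<dots> = b"
    by (simp add: absorb add_lam_e)
  finally show ?thesis
    by blast
qed

lemma ex_idempotent_left_unit: "\<exists>u. u \<oplus> u = u \<and> u \<oplus> b = b"
proof -
  obtain x where x: "b \<oplus> x \<oplus> b = b"
    using add_regular by blast
  have "(b \<oplus> x) \<oplus> (b \<oplus> x) = (b \<oplus> x \<oplus> b) \<oplus> x"
    by (simp only: plus.assoc)
  then show ?thesis
    using x by (intro exI [of _ "b \<oplus> x"]) simp
qed

section \<open>Strongness and the Yang-Baxter equation\<close>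

lemma minv_rho: "minv (rho b a) = minv b \<otimes> (minv a \<oplus> b)"
  by (simp add: rho_bar_def minv_mult)

text \<open>
  The components of the map \<open>r\<close> multiply to the same element as its arguments.  Hence \<open>minv_rho_rho\<close>
  also evaluates a composite of right maps at the components of \<open>r (b, c)\<close>, with the same factor
  \<open>minv (b \<otimes> c)\<close> in front.
\<close>

lemma lam_mult_rho: "lam a b \<otimes> rho b a = a \<otimes> b"
  by (simp add: lambda_bar_def rho_bar_def times.assoc)

lemma minv_rho_rho:
  "minv (rho c (rho b a)) = minv (b \<otimes> c) \<otimes> (minv a \<oplus> b \<otimes> (e \<oplus> c))"
proof -
  have "minv b \<otimes> (minv a \<oplus> b \<otimes> (e \<oplus> c)) = minv b \<otimes> ((minv a \<oplus> b) \<oplus> lam b c)"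
    by (simp add: mult_add plus.assoc)
  also have "\<dots> = minv b \<otimes> (minv a \<oplus> b) \<oplus> c"
    by (subst mult_add) (simp add: lam_minv_cancel)
  finally show ?thesis
    by (simp add: minv_rho minv_mult times.assoc)
qed

lemma strong_iff:
  "strong (\<oplus>) (\<otimes>) minv \<longleftrightarrow> (\<forall>a b c. c \<oplus> a \<otimes> (e \<oplus> b) = c \<oplus> a \<otimes> b)"
proof -
  have "rho (b \<otimes> c) a = rho c (rho b a)
      \<longleftrightarrow> minv a \<oplus> b \<otimes> (e \<oplus> c) = minv a \<oplus> b \<otimes> c" for a b c
    by (metis minv_rho minv_rho_rho mult_minv_cancel(1) times.inverse_inverse)
  then show ?thesis
    unfolding strong_def fun_eq_iff comp_apply
    by (metis times.inverse_inverse)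
qed

text \<open>
  Both sides of the braid relation have the same first component, since \<open>\<lambda>\<close> is multiplicative
  and \<open>r\<close> preserves products, and all three entries multiply to \<open>a \<otimes> b \<otimes> c\<close> on both sides.  Hence
  the second components agree as soon as the third ones do.
\<close>

lemma yang_baxter_iff_rho:
  "yang_baxter_solution (r_bar (\<oplus>) (\<otimes>) minv)
    \<longleftrightarrow> (\<forall>a b c. rho (rho c b) (rho (lam b c) a) = rho c (rho b a))"
    (is "?Y \<longleftrightarrow> (\<forall>a b c. ?third a b c)")
proof -
  define p where "p a b c = lam (lam a b) (lam (rho b a) c)" for a b c
  define q where "q a b c = rho (lam (rho b a) c) (lam a b)" for a b c
  define p' where "p' a b c = lam a (lam b c)" for a b c
  define q' where "q' a b c = lam (rho (lam b c) a) (rho c b)" for a b c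
  have p: "p a b c = p' a b c" for a b c
    unfolding p_def p'_def by (simp add: lam_mult [symmetric] lam_mult_rho)
  have prod: "p a b c \<otimes> (q a b c \<otimes> rho c (rho b a)) = a \<otimes> (b \<otimes> c)" for a b c
    unfolding p_def q_def by (metis lam_mult_rho times.assoc)
  have prod': "p' a b c \<otimes> (q' a b c \<otimes> rho (rho c b) (rho (lam b c) a)) = a \<otimes> (b \<otimes> c)" for a b c
    unfolding p'_def q'_def by (metis lam_mult_rho times.assoc)
  have q: "q a b c = q' a b c" if "?third a b c" for a b c
  proof -
    have "q a b c \<otimes> rho c (rho b a) = q' a b c \<otimes> rho c (rho b a)"
      using prod [of a b c] prod' [of a b c] that p by (metis mult_minv_cancel(2))
    then show ?thesis
      by (metis mult_e times.assoc times.right_inverse)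
  qed
  have "?Y \<longleftrightarrow> (\<forall>a b c. (p a b c, q a b c, rho c (rho b a))
      = (p' a b c, q' a b c, rho (rho c b) (rho (lam b c) a)))"
    unfolding p_def q_def p'_def q'_def
    by (simp add: yang_baxter_solution_def fun_eq_iff prod_id_def id_prod_def r_bar_def)
  then show ?thesis
    using p q by (metis prod.inject)
qed

lemma yang_baxter_iff:
  "yang_baxter_solution (r_bar (\<oplus>) (\<otimes>) minv)
    \<longleftrightarrow> (\<forall>a b c. a \<oplus> lam b c \<otimes> (e \<oplus> rho c b) = a \<oplus> b \<otimes> (e \<oplus> c))"
proof -
  have "rho (rho c b) (rho (lam b c) a) = rho c (rho b a)
      \<longleftrightarrow> minv a \<oplus> lam b c \<otimes> (e \<oplus> rho c b) = minv a \<oplus> b \<otimes> (e \<oplus> c)" for a b c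
    by (metis lam_mult_rho minv_rho_rho mult_minv_cancel(1) times.inverse_inverse)
  then show ?thesis
    unfolding yang_baxter_iff_rho by (metis times.inverse_inverse)
qed

section \<open>The condition on idempotents\<close>

text \<open>Replacing \<open>u\<close> by \<open>e \<oplus> u\<close> makes \<open>a\<close> a summand, and the remaining idempotent vanishes before \<open>e\<close>.\<close>

lemma idempotents_condition_if_add_mult:
  assumes "\<And>a b c. c \<oplus> a \<otimes> (e \<oplus> b) = c \<oplus> a \<otimes> b" and "u \<oplus> u = u"
  shows "e \<oplus> a \<oplus> e = e \<oplus> a \<otimes> u \<oplus> e"
proof -
  have "e \<oplus> a \<otimes> u \<oplus> e = e \<oplus> a \<otimes> (e \<oplus> u) \<oplus> e"
    by (simp add: assms(1))
  also have "\<dots> = e \<oplus> a \<oplus> (lam a u \<oplus> e)"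
    by (simp add: mult_add plus.assoc)
  finally show ?thesis
    by (simp add: lam_idempotent_add_e assms(2))
qed

text \<open>
  An idempotent left unit \<open>u\<close> of \<open>b\<close> splits \<open>a \<otimes> b\<close> into \<open>a \<otimes> u \<oplus> \<lambda>\<^sub>a b\<close>.  With \<open>u\<close> removed this is
  \<open>a \<oplus> \<lambda>\<^sub>a b = a \<otimes> (e \<oplus> b)\<close>.
\<close>

lemma add_mult_if_idempotents_condition:
  assumes "\<And>a u. u \<oplus> u = u \<Longrightarrow> e \<oplus> a \<oplus> e = e \<oplus> a \<otimes> u \<oplus> e"
  shows "c \<oplus> a \<otimes> (e \<oplus> b) = c \<oplus> a \<otimes> b"
proof -
  obtain u where u: "u \<oplus> u = u" "u \<oplus> b = b"
    using ex_idempotent_left_unit by blast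
  \<comment> \<open>Inner summands \<open>e\<close> are inserted freely to bring \<open>a \<otimes> u\<close> into the form needed.\<close>
  have "c \<oplus> a \<otimes> b = c \<oplus> a \<otimes> (u \<oplus> b)"
    by (simp add: u)
  also have "\<dots> = c \<oplus> ((e \<oplus> a \<otimes> u \<oplus> e) \<oplus> lam a b)"
    by (simp add: mult_add plus.assoc)
  also have "\<dots> = c \<oplus> ((e \<oplus> a \<oplus> e) \<oplus> lam a b)"
    by (simp only: assms [OF u(1), symmetric])
  also have "\<dots> = c \<oplus> a \<otimes> (e \<oplus> b)"
    by (simp add: mult_add plus.assoc)
  finally show ?thesis by simp
qed

lemma idempotents_condition_if_yang_baxter_condition:
  assumes "\<And>a b c. a \<oplus> lam b c \<otimes> (e \<oplus> rho c b) = a \<oplus> b \<otimes> (e \<oplus> c)" and "u \<oplus> u = u"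
  shows "e \<oplus> a \<oplus> e = e \<oplus> a \<otimes> u \<oplus> e"
proof -
  \<comment> \<open>The second summand makes \<open>lam a c = e\<close>, so that \<open>rho c a\<close> is just \<open>a \<otimes> c\<close>.\<close>
  define c where "c = u \<oplus> lam (minv a) e"
  have lam: "lam a c = e"
    by (simp add: c_def lam_add lam_minv_cancel lam_idempotent_add_e assms(2))
  have "rho c a = a \<otimes> c"
    using lam_mult_rho [of a c] by (simp add: lam times.group_left_neutral)
  then have "e \<oplus> a \<otimes> c = e \<oplus> a \<otimes> (e \<oplus> c)"
    using assms(1) [of e a c] by (simp add: lam times.group_left_neutral)
  moreover have "a \<otimes> c = a \<otimes> u \<oplus> e"
    by (simp add: c_def mult_add lam_minv_cancel)
  moreover have "a \<otimes> (e \<oplus> c) = a \<oplus> e"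
    by (simp add: mult_add lam)
  ultimately show ?thesis
    by (simp add: plus.assoc)
qed

end

section \<open>The characterisation of strong left semibraces\<close>

theorem theorem3p3:
  fixes add :: "'a \<Rightarrow> 'a \<Rightarrow> 'a" (infixl \<open>\<oplus>\<close> 65)
    and mult :: "'a \<Rightarrow> 'a \<Rightarrow> 'a" (infixl \<open>\<otimes>\<close> 70)
    and e :: 'a
    and minv :: "'a \<Rightarrow> 'a"
  assumes "left_semibrace (\<oplus>) (\<otimes>) e minv"
  shows "(strong (\<oplus>) (\<otimes>) minv \<longleftrightarrow>
        (\<forall>a b c. c \<oplus> a \<otimes> (e \<oplus> b) = c \<oplus> a \<otimes> b)) \<and>
    (strong (\<oplus>) (\<otimes>) minv \<longleftrightarrow>
        (\<forall>a. \<forall>u \<in> idempotents (\<oplus>). e \<oplus> a \<oplus> e = e \<oplus> a \<otimes> u \<oplus> e)) \<and>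
    (strong (\<oplus>) (\<otimes>) minv \<longleftrightarrow>
        yang_baxter_solution (r_bar (\<oplus>) (\<otimes>) minv)) \<and>
    (strong (\<oplus>) (\<otimes>) minv \<longleftrightarrow>
        (\<forall>a b c. a \<oplus> b \<otimes> (minv b \<oplus> c) \<otimes> (e \<oplus> minv (minv b \<oplus> c) \<otimes> c)
               = a \<oplus> b \<otimes> (e \<oplus> c)))"
proof -
  interpret left_semibrace "(\<oplus>)" "(\<otimes>)" e minv
    by (rule assms)
  let ?two = "\<forall>a b c. c \<oplus> a \<otimes> (e \<oplus> b) = c \<oplus> a \<otimes> b"
  let ?three = "\<forall>a. \<forall>u \<in> idempotents (\<oplus>). e \<oplus> a \<oplus> e = e \<oplus> a \<otimes> u \<oplus> e"
  let ?five = "\<forall>a b c. a \<oplus> lam b c \<otimes> (e \<oplus> rho c b) = a \<oplus> b \<otimes> (e \<oplus> c)"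
  have "?two \<Longrightarrow> ?five"
    by (simp add: lam_mult_rho)
  moreover have "?three" if ?five
    unfolding idempotents_def
    using idempotents_condition_if_yang_baxter_condition that by blast
  moreover have "?three" if ?two
    unfolding idempotents_def using idempotents_condition_if_add_mult that by blast
  moreover have "?two" if ?three
    using add_mult_if_idempotents_condition that unfolding idempotents_def by blast
  ultimately have "strong (\<oplus>) (\<otimes>) minv \<longleftrightarrow> ?two" "strong (\<oplus>) (\<otimes>) minv \<longleftrightarrow> ?three"
    "strong (\<oplus>) (\<otimes>) minv \<longleftrightarrow> yang_baxter_solution (r_bar (\<oplus>) (\<otimes>) minv)"
    "strong (\<oplus>) (\<otimes>) minv \<longleftrightarrow> ?five"
    unfolding strong_iff yang_baxter_iff by argo+
  then show ?thesis
    unfolding lambda_bar_def rho_bar_def by blast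
qed

end
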